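(* Let $(X_n)$ and $(Y_n)$ be sequences of random elements of $E_1$ and $E_2$ respectively, all defined on one probability space. 1) (with $E_1,E_2$ Polish) If $(X_n),(Y_n)$ satisfy AI-0, then $(u(X_n)),(v(Y_n))$ satisfy AI-0 for all uniformly continuous functions $u,v$ defined on $E_1$, $E_2$ respectively, with values in Polish spaces. 2) (with $E_1,E_2$ Polish) If $(X_n),(Y_n)$ satisfy AI-1, then $(u(X_n)),(v(Y_n))$ satisfy AI-1 for all uniformly continuous functions $u,v$ defined on $E_1$, $E_2$ respectively, with values in Polish spaces. 3) (with $(E_1,\mathcal{E}_1),(E_2,\mathcal{E}_2)$ arbitrary measurable spaces) If $(X_n),(Y_n)$ satisfy AI-2, then $(u(X_n)),(v(Y_n))$ satisfy AI-2 for all measurable functions $u,v$ defined on $E_1$, $E_2$ respectively, with values in measurable spaces. 4) (with $(E_1,\mathcal{E}_1),(E_2,\mathcal{E}_2)$ arbitrary measurable spaces) If $(X_n),(Y_n)$ satisfy AI-3, then $(u_n(X_n)),(v_n(Y_n))$ satisfy AI-3 for all sequences of measurable functions $u_n,v_n$ defined on $E_1$, $E_2$ respectively, with values in measurable spaces. 5) (with $(E_1,\mathcal{E}_1),(E_2,\mathcal{E}_2)$ arbitrary measurable spaces) If $(X_n),(Y_n)$ satisfy AI-4, then $(u_n(X_n)),(v_n(Y_n))$ satisfy AI-4 for all sequences of measurable functions $u_n,v_n$ defined on $E_1$, $E_2$ respectively, with values in measurable spaces.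
   Context: Polish spaces carry fixed complete separable metrics and their Borel $\sigma$-algebras, and a product of two Polish spaces $(F_1,d_1),(F_2,d_2)$ carries the metric $d_1+d_2$ (or, equivalently, the maximum metric). $P_\xi$ denotes the distribution of a random element $\xi$. For sequences $(\xi_n)$, $(\eta_n)$ of random elements of $(F_1,\mathcal{G}_1)$, $(F_2,\mathcal{G}_2)$ on one probability space, the conditions are (all limits as $n\to+\infty$): AI-0 ($F_1,F_2$ Polish): for all bounded uniformly continuous $f:F_1\to\mathbb{R}$, $g:F_2\to\mathbb{R}$, $\mathbb{E}f(\xi_n)g(\eta_n)-\mathbb{E}f(\xi_n)\,\mathbb{E}g(\eta_n)\to 0$. AI-1 ($F_1,F_2$ Polish): for all bounded uniformly continuous $h:F_1\times F_2\to\mathbb{R}$, $\int h\,dP_{(\xi_n,\eta_n)}-\int h\,d(P_{\xi_n}\times P_{\eta_n})\to 0$. AI-2: for all $A\in\mathcal{G}_1$, $B\in\mathcal{G}_2$, $|P_{(\xi_n,\eta_n)}(A\times B)-P_{\xi_n}(A)P_{\eta_n}(B)|\to 0$. AI-3: $\sup_{A\in\mathcal{G}_1,B\in\mathcal{G}_2}|P_{(\xi_n,\eta_n)}(A\times B)-P_{\xi_n}(A)P_{\eta_n}(B)|\to 0$. AI-4: $\|P_{(\xi_n,\eta_n)}-P_{\xi_n}\times P_{\eta_n}\|_{var}\to 0$, where $\|\cdot\|_{var}$ is the total variation norm. *)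

theory Defs
  imports "HOL-Probability.Probability"
begin

text \<open>
  A Polish space with a fixed complete separable metric is a type of class
  \<^class>\<open>polish_space\<close>; a measurable space is a value of type \<^typ>\<open>'a measure\<close> of which
  only the carrier and the sigma-algebra are used. The predicates below are meant for
  measurable \<open>\<xi> n\<close>, \<open>\<eta> n\<close> on a probability space \<open>M\<close>; measurability is assumed separately.
\<close>

abbreviation joint_law ::
    "'w measure \<Rightarrow> 'a measure \<Rightarrow> 'b measure \<Rightarrow> ('w \<Rightarrow> 'a) \<Rightarrow> ('w \<Rightarrow> 'b) \<Rightarrow> ('a \<times> 'b) measure" where
  "joint_law M G1 G2 \<xi> \<eta> \<equiv> distr M (G1 \<Otimes>\<^sub>M G2) (\<lambda>\<omega>. (\<xi> \<omega>, \<eta> \<omega>))"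

abbreviation product_law ::
    "'w measure \<Rightarrow> 'a measure \<Rightarrow> 'b measure \<Rightarrow> ('w \<Rightarrow> 'a) \<Rightarrow> ('w \<Rightarrow> 'b) \<Rightarrow> ('a \<times> 'b) measure" where
  "product_law M G1 G2 \<xi> \<eta> \<equiv> distr M G1 \<xi> \<Otimes>\<^sub>M distr M G2 \<eta>"

definition AI0 ::
    "'w measure \<Rightarrow> (nat \<Rightarrow> 'w \<Rightarrow> 'a::polish_space) \<Rightarrow> (nat \<Rightarrow> 'w \<Rightarrow> 'b::polish_space) \<Rightarrow> bool" where
  "AI0 M \<xi> \<eta> \<longleftrightarrow>
    (\<forall>(f :: 'a \<Rightarrow> real) (g :: 'b \<Rightarrow> real).
       bounded (range f) \<and> uniformly_continuous_on UNIV f \<and>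
       bounded (range g) \<and> uniformly_continuous_on UNIV g \<longrightarrow>
       (\<lambda>n. (\<integral>\<omega>. f (\<xi> n \<omega>) * g (\<eta> n \<omega>) \<partial>M)
            - (\<integral>\<omega>. f (\<xi> n \<omega>) \<partial>M) * (\<integral>\<omega>. g (\<eta> n \<omega>) \<partial>M)) \<longlonglongrightarrow> 0)"

text \<open>
  Uniform continuity on a product for the metric \<open>d\<^sub>1 + d\<^sub>2\<close>. The library metric on the
  product type is the Euclidean combination \<open>sqrt (d\<^sub>1\<^sup>2 + d\<^sub>2\<^sup>2)\<close>, which is uniformly
  equivalent, so that both notions agree.
\<close>

definition unif_cont_sum_metric ::
    "('a::metric_space \<times> 'b::metric_space \<Rightarrow> real) \<Rightarrow> bool" where
  "unif_cont_sum_metric h \<longleftrightarrow>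
    (\<forall>\<epsilon>>0. \<exists>\<delta>>0. \<forall>x y x' y'.
       dist x x' + dist y y' < \<delta> \<longrightarrow> \<bar>h (x, y) - h (x', y')\<bar> < \<epsilon>)"

lemma unif_cont_sum_metric_iff:
  "unif_cont_sum_metric h \<longleftrightarrow> uniformly_continuous_on UNIV h"
proof
  assume h: "unif_cont_sum_metric h"
  show "uniformly_continuous_on UNIV h"
    unfolding uniformly_continuous_on_def
  proof (intro allI impI)
    fix \<epsilon> :: real assume "\<epsilon> > 0"
    then obtain \<delta> where \<delta>: "\<delta> > 0"
      and *: "\<And>x y x' y'. dist x x' + dist y y' < \<delta> \<Longrightarrow> \<bar>h (x, y) - h (x', y')\<bar> < \<epsilon>"
      using h unfolding unif_cont_sum_metric_def by meson
    have "dist (h p') (h p) < \<epsilon>" if "dist p' p < \<delta> / 2" for p p'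
    proof -
      have "dist (fst p') (fst p) + dist (snd p') (snd p) < \<delta>"
        using that dist_fst_le[of p' p] dist_snd_le[of p' p] by linarith
      from *[OF this] show ?thesis by (simp add: dist_real_def)
    qed
    with \<delta> show "\<exists>d>0. \<forall>x\<in>UNIV. \<forall>x'\<in>UNIV. dist x' x < d \<longrightarrow> dist (h x') (h x) < \<epsilon>"
      by (intro exI[of _ "\<delta> / 2"]) auto
  qed
next
  assume h: "uniformly_continuous_on UNIV h"
  show "unif_cont_sum_metric h"
    unfolding unif_cont_sum_metric_def
  proof (intro allI impI)
    fix \<epsilon> :: real assume "\<epsilon> > 0"
    then obtain \<delta> where \<delta>: "\<delta> > 0"
      and *: "\<And>p p'. dist p' p < \<delta> \<Longrightarrow> dist (h p') (h p) < \<epsilon>"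
      using h unfolding uniformly_continuous_on_def by (metis UNIV_I)
    have "\<bar>h (x, y) - h (x', y')\<bar> < \<epsilon>" if "dist x x' + dist y y' < \<delta>" for x y x' y'
    proof -
      have "dist (x, y) (x', y') \<le> dist x x' + dist y y'"
        unfolding dist_Pair_Pair by (intro sqrt_sum_squares_le_sum) auto
      with that have "dist (x, y) (x', y') < \<delta>" by linarith
      from *[OF this] show ?thesis by (simp add: dist_real_def)
    qed
    with \<delta> show "\<exists>\<delta>>0. \<forall>x y x' y'. dist x x' + dist y y' < \<delta> \<longrightarrow> \<bar>h (x, y) - h (x', y')\<bar> < \<epsilon>"
      by blast
  qed
qed

text \<open>
  By second countability, the product of the Borel sigma-algebras used here is the Borel
  sigma-algebra of the product space (lemma \<open>borel_prod\<close>).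
\<close>

definition AI1 ::
    "'w measure \<Rightarrow> (nat \<Rightarrow> 'w \<Rightarrow> 'a::polish_space) \<Rightarrow> (nat \<Rightarrow> 'w \<Rightarrow> 'b::polish_space) \<Rightarrow> bool" where
  "AI1 M \<xi> \<eta> \<longleftrightarrow>
    (\<forall>h :: 'a \<times> 'b \<Rightarrow> real.
       bounded (range h) \<and> unif_cont_sum_metric h \<longrightarrow>
       (\<lambda>n. (\<integral>p. h p \<partial>joint_law M borel borel (\<xi> n) (\<eta> n))
            - (\<integral>p. h p \<partial>product_law M borel borel (\<xi> n) (\<eta> n))) \<longlonglongrightarrow> 0)"

definition AI2 ::
    "'w measure \<Rightarrow> 'a measure \<Rightarrow> 'b measure \<Rightarrow> (nat \<Rightarrow> 'w \<Rightarrow> 'a) \<Rightarrow> (nat \<Rightarrow> 'w \<Rightarrow> 'b) \<Rightarrow> bool" where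
  "AI2 M G1 G2 \<xi> \<eta> \<longleftrightarrow>
    (\<forall>A\<in>sets G1. \<forall>B\<in>sets G2.
       (\<lambda>n. \<bar>measure (joint_law M G1 G2 (\<xi> n) (\<eta> n)) (A \<times> B)
             - measure (distr M G1 (\<xi> n)) A * measure (distr M G2 (\<eta> n)) B\<bar>) \<longlonglongrightarrow> 0)"

text \<open>The real-valued supremum is over a nonempty set of numbers in the unit interval.\<close>

definition AI3 ::
    "'w measure \<Rightarrow> 'a measure \<Rightarrow> 'b measure \<Rightarrow> (nat \<Rightarrow> 'w \<Rightarrow> 'a) \<Rightarrow> (nat \<Rightarrow> 'w \<Rightarrow> 'b) \<Rightarrow> bool" where
  "AI3 M G1 G2 \<xi> \<eta> \<longleftrightarrow>
    (\<lambda>n. SUP (A, B) \<in> sets G1 \<times> sets G2.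
       \<bar>measure (joint_law M G1 G2 (\<xi> n) (\<eta> n)) (A \<times> B)
        - measure (distr M G1 (\<xi> n)) A * measure (distr M G2 (\<eta> n)) B\<bar>) \<longlonglongrightarrow> 0"

text \<open>
  Total variation norm of a real-valued set function \<open>\<kappa>\<close> (here a difference of two finite
  measures) on the measurable space \<open>S\<close>: the supremum of \<open>\<Sum>\<^sub>i \<bar>\<kappa> A\<^sub>i\<bar>\<close> over finite
  measurable partitions of the space.
\<close>

definition tv_norm :: "'a measure \<Rightarrow> ('a set \<Rightarrow> real) \<Rightarrow> ennreal" where
  "tv_norm S \<kappa> =
    (SUP P \<in> {P. finite P \<and> P \<subseteq> sets S \<and> disjoint P \<and> \<Union>P = space S}.
       ennreal (\<Sum>A\<in>P. \<bar>\<kappa> A\<bar>))"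

definition AI4 ::
    "'w measure \<Rightarrow> 'a measure \<Rightarrow> 'b measure \<Rightarrow> (nat \<Rightarrow> 'w \<Rightarrow> 'a) \<Rightarrow> (nat \<Rightarrow> 'w \<Rightarrow> 'b) \<Rightarrow> bool" where
  "AI4 M G1 G2 \<xi> \<eta> \<longleftrightarrow>
    (\<lambda>n. tv_norm (G1 \<Otimes>\<^sub>M G2)
       (\<lambda>C. measure (joint_law M G1 G2 (\<xi> n) (\<eta> n)) C
            - measure (product_law M G1 G2 (\<xi> n) (\<eta> n)) C)) \<longlonglongrightarrow> 0"

end

theory Submission
  imports Defs
begin

text \<open>
  Each condition compares the joint law of \<open>(X n, Y n)\<close> with the product of the two marginal
  laws, and both of these laws are transformed by the coordinatewise map \<open>(x, y) \<mapsto> (u x, v y)\<close>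
  into the corresponding laws of \<open>(u (X n), v (Y n))\<close> (\<open>joint_law_comp\<close>, \<open>product_law_comp\<close>).
  Hence every test object for the images pulls back to a test object of the same kind for the
  original sequences: \<open>f \<circ> u\<close> and \<open>h \<circ> map_prod u v\<close> are again bounded and uniformly continuous,
  and preimages of measurable rectangles and of finite measurable partitions are again measurable
  rectangles and finite measurable partitions. In \<open>AI2\<close> and \<open>AI3\<close> the discrepancy on a
  rectangle is therefore one of the discrepancies of the original sequences, and the total
  variation norm does not increase under a push-forward (\<open>tv_norm_pushforward_le\<close>). In \<open>AI3\<close>
  and \<open>AI4\<close> the bound holds for each \<open>n\<close> separately, which is why the maps may vary with \<open>n\<close>.
\<close>

section \<open>Laws of images\<close>

lemma joint_law_comp:
  assumes "X \<in> M \<rightarrow>\<^sub>M E1" "Y \<in> M \<rightarrow>\<^sub>M E2" "u \<in> E1 \<rightarrow>\<^sub>M F1" "v \<in> E2 \<rightarrow>\<^sub>M F2"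
  shows "joint_law M F1 F2 (\<lambda>\<omega>. u (X \<omega>)) (\<lambda>\<omega>. v (Y \<omega>)) =
         distr (joint_law M E1 E2 X Y) (F1 \<Otimes>\<^sub>M F2) (map_prod u v)"
proof -
  note [measurable] = assms
  have "map_prod u v \<in> E1 \<Otimes>\<^sub>M E2 \<rightarrow>\<^sub>M F1 \<Otimes>\<^sub>M F2"
    unfolding map_prod_def by measurable
  then show ?thesis
    by (subst distr_distr) (auto simp: comp_def)
qed

lemma (in prob_space) product_law_comp:
  assumes "X \<in> M \<rightarrow>\<^sub>M E1" "Y \<in> M \<rightarrow>\<^sub>M E2" "u \<in> E1 \<rightarrow>\<^sub>M F1" "v \<in> E2 \<rightarrow>\<^sub>M F2"
  shows "product_law M F1 F2 (\<lambda>\<omega>. u (X \<omega>)) (\<lambda>\<omega>. v (Y \<omega>)) =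
         distr (product_law M E1 E2 X Y) (F1 \<Otimes>\<^sub>M F2) (map_prod u v)"
proof -
  note [measurable] = assms
  have "prob_space (distr M F2 (\<lambda>\<omega>. v (Y \<omega>)))"
    by (rule prob_space_distr) measurable
  then have sf: "sigma_finite_measure (distr (distr M E2 Y) F2 v)"
    by (simp add: distr_distr comp_def prob_space_imp_sigma_finite)
  have "product_law M F1 F2 (\<lambda>\<omega>. u (X \<omega>)) (\<lambda>\<omega>. v (Y \<omega>)) =
        distr (distr M E1 X) F1 u \<Otimes>\<^sub>M distr (distr M E2 Y) F2 v"
    by (simp add: distr_distr comp_def)
  also have "\<dots> = distr (product_law M E1 E2 X Y) (F1 \<Otimes>\<^sub>M F2) (\<lambda>(x, y). (u x, v y))"
    by (rule pair_measure_distr[OF _ _ sf]) simp_all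
  finally show ?thesis by (simp add: map_prod_def)
qed

section \<open>Discrepancy on rectangles\<close>

text \<open>How far the joint law is from the product of the marginal laws on the rectangle \<open>A \<times> B\<close>:
  it tends to zero on each rectangle under \<open>AI2\<close> and uniformly over all rectangles under \<open>AI3\<close>.\<close>

definition rect_discrepancy ::
    "'w measure \<Rightarrow> 'a measure \<Rightarrow> 'b measure \<Rightarrow> ('w \<Rightarrow> 'a) \<Rightarrow> ('w \<Rightarrow> 'b) \<Rightarrow> 'a set \<Rightarrow> 'b set \<Rightarrow> real" where
  "rect_discrepancy M G1 G2 \<xi> \<eta> A B =
     \<bar>measure (joint_law M G1 G2 \<xi> \<eta>) (A \<times> B)
      - measure (distr M G1 \<xi>) A * measure (distr M G2 \<eta>) B\<bar>"

lemma AI2_iff_rect_discrepancy: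
  "AI2 M G1 G2 \<xi> \<eta> \<longleftrightarrow>
    (\<forall>A\<in>sets G1. \<forall>B\<in>sets G2. (\<lambda>n. rect_discrepancy M G1 G2 (\<xi> n) (\<eta> n) A B) \<longlonglongrightarrow> 0)"
  unfolding AI2_def rect_discrepancy_def ..

lemma AI3_iff_rect_discrepancy:
  "AI3 M G1 G2 \<xi> \<eta> \<longleftrightarrow>
    (\<lambda>n. SUP (A, B) \<in> sets G1 \<times> sets G2. rect_discrepancy M G1 G2 (\<xi> n) (\<eta> n) A B) \<longlonglongrightarrow> 0"
  unfolding AI3_def rect_discrepancy_def ..

lemma rect_discrepancy_comp:
  assumes meas: "X \<in> M \<rightarrow>\<^sub>M E1" "Y \<in> M \<rightarrow>\<^sub>M E2" "u \<in> E1 \<rightarrow>\<^sub>M F1" "v \<in> E2 \<rightarrow>\<^sub>M F2"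
    and AB: "A \<in> sets F1" "B \<in> sets F2"
  shows "rect_discrepancy M F1 F2 (\<lambda>\<omega>. u (X \<omega>)) (\<lambda>\<omega>. v (Y \<omega>)) A B =
         rect_discrepancy M E1 E2 X Y (u -` A \<inter> space E1) (v -` B \<inter> space E2)"
proof -
  note [measurable] = meas
  have T: "map_prod u v \<in> E1 \<Otimes>\<^sub>M E2 \<rightarrow>\<^sub>M F1 \<Otimes>\<^sub>M F2"
    unfolding map_prod_def by measurable
  have "map_prod u v -` (A \<times> B) \<inter> space (E1 \<Otimes>\<^sub>M E2) =
        (u -` A \<inter> space E1) \<times> (v -` B \<inter> space E2)"
    by (auto simp: space_pair_measure)
  with T AB have "measure (joint_law M F1 F2 (\<lambda>\<omega>. u (X \<omega>)) (\<lambda>\<omega>. v (Y \<omega>))) (A \<times> B) =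
      measure (joint_law M E1 E2 X Y) ((u -` A \<inter> space E1) \<times> (v -` B \<inter> space E2))"
    by (simp add: joint_law_comp[OF meas] measure_distr)
  moreover have "measure (distr M F1 (\<lambda>\<omega>. u (X \<omega>))) A = measure (distr M E1 X) (u -` A \<inter> space E1)"
    using AB measure_distr[of u "distr M E1 X" F1 A] by (simp add: distr_distr comp_def)
  moreover have "measure (distr M F2 (\<lambda>\<omega>. v (Y \<omega>))) B = measure (distr M E2 Y) (v -` B \<inter> space E2)"
    using AB measure_distr[of v "distr M E2 Y" F2 B] by (simp add: distr_distr comp_def)
  ultimately show ?thesis
    unfolding rect_discrepancy_def by simp
qed

lemma (in prob_space) rect_discrepancy_le_1:
  assumes [measurable]: "X \<in> M \<rightarrow>\<^sub>M E1" "Y \<in> M \<rightarrow>\<^sub>M E2"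
  shows "rect_discrepancy M E1 E2 X Y A B \<le> 1"
proof -
  interpret P: prob_space "joint_law M E1 E2 X Y" by (rule prob_space_distr) measurable
  interpret P1: prob_space "distr M E1 X" by (rule prob_space_distr) measurable
  interpret P2: prob_space "distr M E2 Y" by (rule prob_space_distr) measurable
  have "P1.prob A * P2.prob B \<le> 1" by (simp add: mult_le_one)
  moreover have "0 \<le> P1.prob A * P2.prob B" by simp
  moreover have "P.prob (A \<times> B) \<le> 1" "0 \<le> P.prob (A \<times> B)" by simp_all
  ultimately show ?thesis unfolding rect_discrepancy_def abs_le_iff by linarith
qed

text \<open>By \<open>rect_discrepancy_le_1\<close> the real-valued supremum on the right is taken over a bounded
  set, so that it dominates each discrepancy.\<close>

lemma (in prob_space) SUP_rect_discrepancy_comp_le: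
  assumes meas: "X \<in> M \<rightarrow>\<^sub>M E1" "Y \<in> M \<rightarrow>\<^sub>M E2" "u \<in> E1 \<rightarrow>\<^sub>M F1" "v \<in> E2 \<rightarrow>\<^sub>M F2"
  shows "(SUP (A, B) \<in> sets F1 \<times> sets F2.
            rect_discrepancy M F1 F2 (\<lambda>\<omega>. u (X \<omega>)) (\<lambda>\<omega>. v (Y \<omega>)) A B)
       \<le> (SUP (A, B) \<in> sets E1 \<times> sets E2. rect_discrepancy M E1 E2 X Y A B)"
proof (rule cSUP_least, use sets.empty_sets in blast)
  fix p assume "p \<in> sets F1 \<times> sets F2"
  then obtain A B where p: "p = (A, B)" and AB: "A \<in> sets F1" "B \<in> sets F2" by auto
  let ?q = "(u -` A \<inter> space E1, v -` B \<inter> space E2)"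
  have "bdd_above ((\<lambda>(A, B). rect_discrepancy M E1 E2 X Y A B) ` (sets E1 \<times> sets E2))"
    using rect_discrepancy_le_1[OF meas(1,2)] by (intro bdd_aboveI[of _ 1]) auto
  moreover have "?q \<in> sets E1 \<times> sets E2"
    using meas AB by (simp add: measurable_sets)
  ultimately have "(\<lambda>(A, B). rect_discrepancy M E1 E2 X Y A B) ?q
      \<le> (SUP (A, B) \<in> sets E1 \<times> sets E2. rect_discrepancy M E1 E2 X Y A B)"
    by (intro cSUP_upper)
  then show "(case p of (A, B) \<Rightarrow> rect_discrepancy M F1 F2 (\<lambda>\<omega>. u (X \<omega>)) (\<lambda>\<omega>. v (Y \<omega>)) A B)
      \<le> (SUP (A, B) \<in> sets E1 \<times> sets E2. rect_discrepancy M E1 E2 X Y A B)"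
    using rect_discrepancy_comp[OF meas AB] by (simp add: p)
qed

lemma (in prob_space) SUP_rect_discrepancy_nonneg:
  assumes meas: "X \<in> M \<rightarrow>\<^sub>M E1" "Y \<in> M \<rightarrow>\<^sub>M E2"
  shows "0 \<le> (SUP (A, B) \<in> sets E1 \<times> sets E2. rect_discrepancy M E1 E2 X Y A B)"
proof -
  have "bdd_above ((\<lambda>(A, B). rect_discrepancy M E1 E2 X Y A B) ` (sets E1 \<times> sets E2))"
    using rect_discrepancy_le_1[OF meas] by (intro bdd_aboveI[of _ 1]) auto
  then show ?thesis
    by (intro cSUP_upper2[of _ _ "({}, {})"]) (auto simp: rect_discrepancy_def)
qed

section \<open>Total variation and push-forwards\<close>

lemma tv_norm_pushforward_le:
  assumes T: "T \<in> S \<rightarrow>\<^sub>M S'"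
    and empty: "\<kappa> {} = 0"
    and push: "\<And>C. C \<in> sets S' \<Longrightarrow> \<kappa>' C = \<kappa> (T -` C \<inter> space S)"
  shows "tv_norm S' \<kappa>' \<le> tv_norm S \<kappa>"
  unfolding tv_norm_def
proof (rule SUP_least)
  fix P assume "P \<in> {P. finite P \<and> P \<subseteq> sets S' \<and> disjoint P \<and> \<Union>P = space S'}"
  then have P: "finite P" "P \<subseteq> sets S'" "disjoint P" "\<Union>P = space S'" by auto
  define pre where "pre C = T -` C \<inter> space S" for C
  have disj: "pre C \<inter> pre D = {}" if "C \<in> P" "D \<in> P" "C \<noteq> D" for C D
    using P(3) that by (auto simp: disjoint_def pre_def)
  have "(\<Sum>C\<in>P. \<bar>\<kappa>' C\<bar>) = (\<Sum>C\<in>P. \<bar>\<kappa> (pre C)\<bar>)"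
    using P(2) push by (intro sum.cong) (auto simp: pre_def)
  \<comment> \<open>Distinct cells have distinct preimages unless both are empty, and the empty set
      contributes nothing to the sum.\<close>
  also have "\<dots> = (\<Sum>A\<in>pre ` P. \<bar>\<kappa> A\<bar>)"
    using P(1) disj empty by (subst sum.reindex_nontrivial) force+
  finally have sum_eq: "(\<Sum>C\<in>P. \<bar>\<kappa>' C\<bar>) = (\<Sum>A\<in>pre ` P. \<bar>\<kappa> A\<bar>)" .
  have "pre ` P \<subseteq> sets S"
    using P(2) T by (auto simp: pre_def intro: measurable_sets)
  moreover have "disjoint (pre ` P)"
    using disj by (fastforce simp: disjoint_def)
  moreover have "\<Union>(pre ` P) = space S"
    using P(4)[symmetric] measurable_space[OF T] by (auto simp: pre_def)
  ultimately show "ennreal (\<Sum>C\<in>P. \<bar>\<kappa>' C\<bar>)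
      \<le> (SUP P \<in> {P. finite P \<and> P \<subseteq> sets S \<and> disjoint P \<and> \<Union>P = space S}. ennreal (\<Sum>A\<in>P. \<bar>\<kappa> A\<bar>))"
    unfolding sum_eq using P(1) by (intro SUP_upper) auto
qed

section \<open>Stability of the five conditions\<close>

lemma uniformly_continuous_on_UNIV_compose:
  fixes u :: "'a::metric_space \<Rightarrow> 'b::metric_space" and f :: "'b \<Rightarrow> 'c::metric_space"
  assumes u: "uniformly_continuous_on UNIV u" and f: "uniformly_continuous_on UNIV f"
  shows "uniformly_continuous_on UNIV (\<lambda>x. f (u x))"
  using u f unfolding uniformly_continuous_on_def by simp meson

lemma AI0_comp:
  fixes X :: "nat \<Rightarrow> 'w \<Rightarrow> 'a::polish_space" and Y :: "nat \<Rightarrow> 'w \<Rightarrow> 'b::polish_space"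
    and u :: "'a \<Rightarrow> 'c::polish_space" and v :: "'b \<Rightarrow> 'd::polish_space"
  assumes "AI0 M X Y" and u: "uniformly_continuous_on UNIV u" and v: "uniformly_continuous_on UNIV v"
  shows "AI0 M (\<lambda>n \<omega>. u (X n \<omega>)) (\<lambda>n \<omega>. v (Y n \<omega>))"
  unfolding AI0_def
proof (intro allI impI, elim conjE)
  fix f :: "'c \<Rightarrow> real" and g :: "'d \<Rightarrow> real"
  assume f: "bounded (range f)" "uniformly_continuous_on UNIV f"
    and g: "bounded (range g)" "uniformly_continuous_on UNIV g"
  have "uniformly_continuous_on UNIV (\<lambda>x. f (u x))" "uniformly_continuous_on UNIV (\<lambda>y. g (v y))"
    using u v f(2) g(2) by (auto intro: uniformly_continuous_on_UNIV_compose)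
  moreover have "bounded (range (\<lambda>x. f (u x)))" "bounded (range (\<lambda>y. g (v y)))"
    by (auto intro: bounded_subset[OF f(1)] bounded_subset[OF g(1)])
  ultimately show "(\<lambda>n. (\<integral>\<omega>. f (u (X n \<omega>)) * g (v (Y n \<omega>)) \<partial>M)
      - (\<integral>\<omega>. f (u (X n \<omega>)) \<partial>M) * (\<integral>\<omega>. g (v (Y n \<omega>)) \<partial>M)) \<longlonglongrightarrow> 0"
    using assms(1) unfolding AI0_def by blast
qed

lemma unif_cont_sum_metric_map_prod:
  assumes h: "unif_cont_sum_metric h"
    and u: "uniformly_continuous_on UNIV u" and v: "uniformly_continuous_on UNIV v"
  shows "unif_cont_sum_metric (\<lambda>p. h (map_prod u v p))"
  unfolding unif_cont_sum_metric_def
proof (intro allI impI)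
  fix \<epsilon> :: real assume "\<epsilon> > 0"
  then obtain \<delta> where "\<delta> > 0" and
    \<delta>: "\<And>x y x' y'. dist x x' + dist y y' < \<delta> \<Longrightarrow> \<bar>h (x, y) - h (x', y')\<bar> < \<epsilon>"
    using h unfolding unif_cont_sum_metric_def by meson
  have "\<delta> / 2 > 0" using \<open>\<delta> > 0\<close> by simp
  obtain a where "a > 0" and a: "\<And>x x'. dist x x' < a \<Longrightarrow> dist (u x) (u x') < \<delta> / 2"
    using u \<open>\<delta> / 2 > 0\<close> unfolding uniformly_continuous_on_def by (metis UNIV_I)
  obtain b where "b > 0" and b: "\<And>y y'. dist y y' < b \<Longrightarrow> dist (v y) (v y') < \<delta> / 2"
    using v \<open>\<delta> / 2 > 0\<close> unfolding uniformly_continuous_on_def by (metis UNIV_I)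
  have "\<bar>h (map_prod u v (x, y)) - h (map_prod u v (x', y'))\<bar> < \<epsilon>"
    if "dist x x' + dist y y' < min a b" for x y x' y'
  proof -
    have "dist x x' < a" "dist y y' < b"
      using that zero_le_dist[of x x'] zero_le_dist[of y y'] by linarith+
    then have "dist (u x) (u x') + dist (v y) (v y') < \<delta>" using a b by fastforce
    from \<delta>[OF this] show ?thesis by simp
  qed
  with \<open>a > 0\<close> \<open>b > 0\<close> show "\<exists>\<delta>>0. \<forall>x y x' y'. dist x x' + dist y y' < \<delta> \<longrightarrow>
      \<bar>h (map_prod u v (x, y)) - h (map_prod u v (x', y'))\<bar> < \<epsilon>"
    by (intro exI[of _ "min a b"]) auto
qed

lemma (in prob_space) AI1_comp:
  fixes X :: "nat \<Rightarrow> 'a \<Rightarrow> 'b::polish_space" and Y :: "nat \<Rightarrow> 'a \<Rightarrow> 'c::polish_space"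
    and u :: "'b \<Rightarrow> 'd::polish_space" and v :: "'c \<Rightarrow> 'e::polish_space"
  assumes XY: "\<And>n. X n \<in> M \<rightarrow>\<^sub>M borel" "\<And>n. Y n \<in> M \<rightarrow>\<^sub>M borel"
    and "AI1 M X Y" and u: "uniformly_continuous_on UNIV u" and v: "uniformly_continuous_on UNIV v"
  shows "AI1 M (\<lambda>n \<omega>. u (X n \<omega>)) (\<lambda>n \<omega>. v (Y n \<omega>))"
  unfolding AI1_def
proof (intro allI impI, elim conjE)
  fix h :: "'d \<times> 'e \<Rightarrow> real"
  assume bdd: "bounded (range h)" and uc: "unif_cont_sum_metric h"
  have uv [measurable]: "u \<in> borel \<rightarrow>\<^sub>M borel" "v \<in> borel \<rightarrow>\<^sub>M borel"
    using u v by (auto intro: borel_measurable_continuous_onI uniformly_continuous_imp_continuous)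
  have T: "map_prod u v \<in> borel \<Otimes>\<^sub>M borel \<rightarrow>\<^sub>M borel \<Otimes>\<^sub>M borel"
    unfolding map_prod_def by measurable
  have h: "h \<in> borel \<Otimes>\<^sub>M borel \<rightarrow>\<^sub>M borel"
    using uc unfolding unif_cont_sum_metric_iff borel_prod
    by (intro borel_measurable_continuous_onI uniformly_continuous_imp_continuous)
  let ?h = "\<lambda>p. h (map_prod u v p)"
  have "bounded (range ?h)" by (auto intro: bounded_subset[OF bdd])
  with unif_cont_sum_metric_map_prod[OF uc u v] \<open>AI1 M X Y\<close>
  have "(\<lambda>n. (\<integral>p. ?h p \<partial>joint_law M borel borel (X n) (Y n))
      - (\<integral>p. ?h p \<partial>product_law M borel borel (X n) (Y n))) \<longlonglongrightarrow> 0"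
    unfolding AI1_def by blast
  moreover have "(\<integral>p. h p \<partial>joint_law M borel borel (\<lambda>\<omega>. u (X n \<omega>)) (\<lambda>\<omega>. v (Y n \<omega>))) =
      (\<integral>p. ?h p \<partial>joint_law M borel borel (X n) (Y n))" for n
    unfolding joint_law_comp[OF XY uv] by (rule integral_distr) (use T h in simp_all)
  moreover have "(\<integral>p. h p \<partial>product_law M borel borel (\<lambda>\<omega>. u (X n \<omega>)) (\<lambda>\<omega>. v (Y n \<omega>))) =
      (\<integral>p. ?h p \<partial>product_law M borel borel (X n) (Y n))" for n
    unfolding product_law_comp[OF XY uv]
    by (rule integral_distr) (use T h in \<open>simp_all cong: measurable_cong_sets\<close>)
  ultimately show "(\<lambda>n. (\<integral>p. h p \<partial>joint_law M borel borel (\<lambda>\<omega>. u (X n \<omega>)) (\<lambda>\<omega>. v (Y n \<omega>)))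
      - (\<integral>p. h p \<partial>product_law M borel borel (\<lambda>\<omega>. u (X n \<omega>)) (\<lambda>\<omega>. v (Y n \<omega>)))) \<longlonglongrightarrow> 0"
    by simp
qed

lemma AI2_comp:
  assumes XY: "\<And>n. X n \<in> M \<rightarrow>\<^sub>M E1" "\<And>n. Y n \<in> M \<rightarrow>\<^sub>M E2"
    and "AI2 M E1 E2 X Y" and uv: "u \<in> E1 \<rightarrow>\<^sub>M F1" "v \<in> E2 \<rightarrow>\<^sub>M F2"
  shows "AI2 M F1 F2 (\<lambda>n \<omega>. u (X n \<omega>)) (\<lambda>n \<omega>. v (Y n \<omega>))"
  unfolding AI2_iff_rect_discrepancy
proof (intro ballI)
  fix A B assume AB: "A \<in> sets F1" "B \<in> sets F2"
  have "(\<lambda>n. rect_discrepancy M E1 E2 (X n) (Y n) (u -` A \<inter> space E1) (v -` B \<inter> space E2)) \<longlonglongrightarrow> 0"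
    using assms(3) measurable_sets[OF uv(1) AB(1)] measurable_sets[OF uv(2) AB(2)]
    unfolding AI2_iff_rect_discrepancy by blast
  then show "(\<lambda>n. rect_discrepancy M F1 F2 (\<lambda>\<omega>. u (X n \<omega>)) (\<lambda>\<omega>. v (Y n \<omega>)) A B) \<longlonglongrightarrow> 0"
    by (simp only: rect_discrepancy_comp[OF XY uv AB])
qed

lemma (in prob_space) AI3_comp:
  assumes XY: "\<And>n. X n \<in> M \<rightarrow>\<^sub>M E1" "\<And>n. Y n \<in> M \<rightarrow>\<^sub>M E2"
    and "AI3 M E1 E2 X Y" and uv: "\<And>n. u n \<in> E1 \<rightarrow>\<^sub>M F1" "\<And>n. v n \<in> E2 \<rightarrow>\<^sub>M F2"
  shows "AI3 M F1 F2 (\<lambda>n \<omega>. u n (X n \<omega>)) (\<lambda>n \<omega>. v n (Y n \<omega>))"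
proof -
  have "\<And>n. (\<lambda>\<omega>. u n (X n \<omega>)) \<in> M \<rightarrow>\<^sub>M F1" "\<And>n. (\<lambda>\<omega>. v n (Y n \<omega>)) \<in> M \<rightarrow>\<^sub>M F2"
    using measurable_compose[OF XY(1) uv(1)] measurable_compose[OF XY(2) uv(2)] by blast+
  note nonneg = SUP_rect_discrepancy_nonneg[OF this]
  show ?thesis
    unfolding AI3_iff_rect_discrepancy
    by (rule tendsto_sandwich[OF always_eventually always_eventually tendsto_const
          assms(3)[unfolded AI3_iff_rect_discrepancy]])
       (use nonneg SUP_rect_discrepancy_comp_le[OF XY uv] in blast)+
qed

lemma (in prob_space) AI4_comp:
  assumes XY: "\<And>n. X n \<in> M \<rightarrow>\<^sub>M E1" "\<And>n. Y n \<in> M \<rightarrow>\<^sub>M E2"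
    and "AI4 M E1 E2 X Y" and uv: "\<And>n. u n \<in> E1 \<rightarrow>\<^sub>M F1" "\<And>n. v n \<in> E2 \<rightarrow>\<^sub>M F2"
  shows "AI4 M F1 F2 (\<lambda>n \<omega>. u n (X n \<omega>)) (\<lambda>n \<omega>. v n (Y n \<omega>))"
proof -
  let ?\<kappa> = "\<lambda>n C. measure (joint_law M E1 E2 (X n) (Y n)) C
                - measure (product_law M E1 E2 (X n) (Y n)) C"
  let ?\<kappa>' = "\<lambda>n C. measure (joint_law M F1 F2 (\<lambda>\<omega>. u n (X n \<omega>)) (\<lambda>\<omega>. v n (Y n \<omega>))) C
                - measure (product_law M F1 F2 (\<lambda>\<omega>. u n (X n \<omega>)) (\<lambda>\<omega>. v n (Y n \<omega>))) C"
  have "tv_norm (F1 \<Otimes>\<^sub>M F2) (?\<kappa>' n) \<le> tv_norm (E1 \<Otimes>\<^sub>M E2) (?\<kappa> n)" for n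
  proof (rule tv_norm_pushforward_le)
    note [measurable] = uv
    show T: "map_prod (u n) (v n) \<in> E1 \<Otimes>\<^sub>M E2 \<rightarrow>\<^sub>M F1 \<Otimes>\<^sub>M F2"
      unfolding map_prod_def by measurable
    then have T': "map_prod (u n) (v n) \<in> product_law M E1 E2 (X n) (Y n) \<rightarrow>\<^sub>M F1 \<Otimes>\<^sub>M F2"
      by (simp cong: measurable_cong_sets)
    show "?\<kappa>' n C = ?\<kappa> n (map_prod (u n) (v n) -` C \<inter> space (E1 \<Otimes>\<^sub>M E2))"
      if "C \<in> sets (F1 \<Otimes>\<^sub>M F2)" for C
      unfolding joint_law_comp[OF XY uv] product_law_comp[OF XY uv]
      using that T T' by (simp add: measure_distr space_pair_measure)
  qed simp
  then show ?thesis
    using tendsto_sandwich[OF always_eventually always_eventually tendsto_const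
        assms(3)[unfolded AI4_def]]
    unfolding AI4_def by simp
qed

theorem proposition8:
  fixes M :: "'w measure"
  assumes "prob_space M"
  shows
   "(\<forall>(X :: nat \<Rightarrow> 'w \<Rightarrow> 'a::polish_space) (Y :: nat \<Rightarrow> 'w \<Rightarrow> 'b::polish_space).
       (\<forall>n. X n \<in> M \<rightarrow>\<^sub>M borel) \<and> (\<forall>n. Y n \<in> M \<rightarrow>\<^sub>M borel) \<and> AI0 M X Y \<longrightarrow>
       (\<forall>(u :: 'a \<Rightarrow> 'c::polish_space) (v :: 'b \<Rightarrow> 'd::polish_space).
          uniformly_continuous_on UNIV u \<and> uniformly_continuous_on UNIV v \<longrightarrow>
          AI0 M (\<lambda>n \<omega>. u (X n \<omega>)) (\<lambda>n \<omega>. v (Y n \<omega>))))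
    \<and>
    (\<forall>(X :: nat \<Rightarrow> 'w \<Rightarrow> 'a) (Y :: nat \<Rightarrow> 'w \<Rightarrow> 'b).
       (\<forall>n. X n \<in> M \<rightarrow>\<^sub>M borel) \<and> (\<forall>n. Y n \<in> M \<rightarrow>\<^sub>M borel) \<and> AI1 M X Y \<longrightarrow>
       (\<forall>(u :: 'a \<Rightarrow> 'c) (v :: 'b \<Rightarrow> 'd).
          uniformly_continuous_on UNIV u \<and> uniformly_continuous_on UNIV v \<longrightarrow>
          AI1 M (\<lambda>n \<omega>. u (X n \<omega>)) (\<lambda>n \<omega>. v (Y n \<omega>))))
    \<and>
    (\<forall>(E1 :: 'e measure) (E2 :: 'f measure) X Y.
       (\<forall>n. X n \<in> M \<rightarrow>\<^sub>M E1) \<and> (\<forall>n. Y n \<in> M \<rightarrow>\<^sub>M E2) \<and> AI2 M E1 E2 X Y \<longrightarrow>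
       (\<forall>(F1 :: 'g measure) (F2 :: 'h measure) u v.
          u \<in> E1 \<rightarrow>\<^sub>M F1 \<and> v \<in> E2 \<rightarrow>\<^sub>M F2 \<longrightarrow>
          AI2 M F1 F2 (\<lambda>n \<omega>. u (X n \<omega>)) (\<lambda>n \<omega>. v (Y n \<omega>))))
    \<and>
    (\<forall>(E1 :: 'e measure) (E2 :: 'f measure) X Y.
       (\<forall>n. X n \<in> M \<rightarrow>\<^sub>M E1) \<and> (\<forall>n. Y n \<in> M \<rightarrow>\<^sub>M E2) \<and> AI3 M E1 E2 X Y \<longrightarrow>
       (\<forall>(F1 :: 'g measure) (F2 :: 'h measure) u v.
          (\<forall>n. u n \<in> E1 \<rightarrow>\<^sub>M F1) \<and> (\<forall>n. v n \<in> E2 \<rightarrow>\<^sub>M F2) \<longrightarrow>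
          AI3 M F1 F2 (\<lambda>n \<omega>. u n (X n \<omega>)) (\<lambda>n \<omega>. v n (Y n \<omega>))))
    \<and>
    (\<forall>(E1 :: 'e measure) (E2 :: 'f measure) X Y.
       (\<forall>n. X n \<in> M \<rightarrow>\<^sub>M E1) \<and> (\<forall>n. Y n \<in> M \<rightarrow>\<^sub>M E2) \<and> AI4 M E1 E2 X Y \<longrightarrow>
       (\<forall>(F1 :: 'g measure) (F2 :: 'h measure) u v.
          (\<forall>n. u n \<in> E1 \<rightarrow>\<^sub>M F1) \<and> (\<forall>n. v n \<in> E2 \<rightarrow>\<^sub>M F2) \<longrightarrow>
          AI4 M F1 F2 (\<lambda>n \<omega>. u n (X n \<omega>)) (\<lambda>n \<omega>. v n (Y n \<omega>))))"
proof -
  interpret prob_space M by fact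
  show ?thesis
    by (intro conjI allI impI; elim conjE)
       (rule AI0_comp AI1_comp AI2_comp AI3_comp AI4_comp; blast)+
qed

end
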